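(* For all nonnegative integers $m,n$, let $U_{m,n}$ be a configuration consisting of $m$ points $x_1,\dots,x_m$ on the positive real axis and $n$ points $y_1,\dots,y_n$ on the positive imaginary axis of $\mathbb{C}$, and let $V_{m,n}=U_{m,n}\cup\{0\}$. Then the lattices $\textsc{NC}(U_{m,n})$ and $\textsc{NC}(V_{m,n})$ both admit symmetric chain decompositions.
   Context: For a finite set $P\subset\mathbb{C}$, a partition of $P$ is noncrossing if the convex hulls of its blocks are pairwise disjoint; $\textsc{NC}(P)$ is the set of noncrossing partitions of $P$ ordered by refinement ($\pi\le\mu$ iff every block of $\mu$ is a union of blocks of $\pi$). $\textsc{NC}(P)$ is graded with rank function $\rho(\pi)=|P|-(\text{number of blocks of }\pi)$, so the minimum has rank $0$ and the maximum has rank $|P|-1$. A chain $c_1<c_2<\dots<c_k$ is saturated if each $c_{i+1}$ covers $c_i$, and it is centered (symmetric) if $\rho(c_1)+\rho(c_k)$ equals the rank of the maximum plus the rank of the minimum, i.e. $|P|-1$. A symmetric chain decomposition is a partition of the poset's elements into disjoint saturated centered chains. *)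

theory Defs
  imports "HOL-Analysis.Analysis" "HOL-Algebra.Lattice"
begin

section \<open>Saturated chains and symmetric chain decompositions\<close>

definition covers :: "('a, 'b) gorder_scheme \<Rightarrow> 'a \<Rightarrow> 'a \<Rightarrow> bool" where
  "covers L b a \<longleftrightarrow> a \<in> carrier L \<and> b \<in> carrier L \<and> a \<sqsubset>\<^bsub>L\<^esub> b \<and>
     \<not> (\<exists>z\<in>carrier L. a \<sqsubset>\<^bsub>L\<^esub> z \<and> z \<sqsubset>\<^bsub>L\<^esub> b)"

definition saturated_chain :: "('a, 'b) gorder_scheme \<Rightarrow> 'a list \<Rightarrow> bool" where
  "saturated_chain L c \<longleftrightarrow>
     c \<noteq> [] \<and> set c \<subseteq> carrier L \<and> successively (\<lambda>a b. covers L b a) c"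

text \<open>The library's bottom and top are chosen by Hilbert choice; for the posets of interest they
  exist and have ranks \<open>0\<close> and \<open>|P| - 1\<close>, see \<open>nc_rank_bottom\<close> and \<open>nc_rank_top\<close> below.\<close>

definition centered_chain :: "('a, 'b) gorder_scheme \<Rightarrow> ('a \<Rightarrow> nat) \<Rightarrow> 'a list \<Rightarrow> bool" where
  "centered_chain L \<rho> c \<longleftrightarrow> \<rho> (hd c) + \<rho> (last c) = \<rho> \<top>\<^bsub>L\<^esub> + \<rho> \<bottom>\<^bsub>L\<^esub>"

definition symmetric_chain_decomposition ::
    "('a, 'b) gorder_scheme \<Rightarrow> ('a \<Rightarrow> nat) \<Rightarrow> 'a set set \<Rightarrow> bool" where
  "symmetric_chain_decomposition L \<rho> D \<longleftrightarrow> partition_on (carrier L) D \<and>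
     (\<forall>C\<in>D. \<exists>c. set c = C \<and> saturated_chain L c \<and> centered_chain L \<rho> c)"


section \<open>Noncrossing partitions of planar point sets\<close>

definition noncrossing :: "complex set set \<Rightarrow> bool" where
  "noncrossing \<pi> \<longleftrightarrow> pairwise (\<lambda>B C. disjnt (convex hull B) (convex hull C)) \<pi>"

definition NC :: "complex set \<Rightarrow> complex set set gorder" where
  "NC P = \<lparr>carrier = {\<pi>. partition_on P \<pi> \<and> noncrossing \<pi>}, eq = (=), le = refines P\<rparr>"

text \<open>A partition of a finite \<open>P\<close> has at most \<open>card P\<close> blocks, so the subtraction never truncates.\<close>

definition nc_rank :: "complex set \<Rightarrow> complex set set \<Rightarrow> nat" where
  "nc_rank P \<pi> = card P - card \<pi>"


section \<open>Basic facts\<close>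

lemma refines_iff_union_of_blocks:
  "refines A P Q \<longleftrightarrow> partition_on A P \<and> partition_on A Q \<and> (\<forall>Y\<in>Q. \<exists>S\<subseteq>P. Y = \<Union>S)"
proof
  assume r: "refines A P Q"
  have "\<exists>S\<subseteq>P. Y = \<Union>S" if "Y \<in> Q" for Y
  proof (intro exI conjI)
    show "Y = \<Union>{p \<in> P. p \<subseteq> Y}"
      by (rule partition_onD1[OF refines_obtains_subset[OF r that]])
  qed simp
  then show "partition_on A P \<and> partition_on A Q \<and> (\<forall>Y\<in>Q. \<exists>S\<subseteq>P. Y = \<Union>S)"
    using r unfolding refines_def by blast
next
  assume "partition_on A P \<and> partition_on A Q \<and> (\<forall>Y\<in>Q. \<exists>S\<subseteq>P. Y = \<Union>S)"
  then have P: "partition_on A P" and Q: "partition_on A Q"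
    and u: "\<And>Y. Y \<in> Q \<Longrightarrow> \<exists>S\<subseteq>P. Y = \<Union>S"
    by simp_all
  have "\<exists>Y\<in>Q. X \<subseteq> Y" if X: "X \<in> P" for X
  proof -
    have "X \<noteq> {}" "X \<subseteq> \<Union>Q"
      using X partition_onD1[OF P] partition_onD1[OF Q] partition_onD3[OF P] by auto
    then obtain p Y where p: "p \<in> X" "p \<in> Y" and Y: "Y \<in> Q"
      by blast
    obtain S where S: "S \<subseteq> P" "Y = \<Union>S"
      using u[OF Y] by blast
    obtain Z where Z: "Z \<in> S" "p \<in> Z"
      using p S by blast
    have "Z = X"
      using disjointD[OF partition_onD2[OF P], of Z X] Z S X p by blast
    with Z S Y show ?thesis by blast
  qed
  with P Q show "refines A P Q" by (simp add: refines_def)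
qed

lemma noncrossing_common_refinement:
  assumes "\<And>\<pi>. \<pi> \<in> \<P> \<Longrightarrow> noncrossing \<pi>"
  shows "noncrossing (common_refinement \<P>)"
  unfolding noncrossing_def pairwise_def
proof (intro ballI impI)
  fix B C
  assume "B \<in> common_refinement \<P>" "C \<in> common_refinement \<P>" "B \<noteq> C"
  then obtain f g where f: "\<And>\<pi>. \<pi> \<in> \<P> \<Longrightarrow> f \<pi> \<in> \<pi>" "B = \<Inter> (f ` \<P>)"
    and g: "\<And>\<pi>. \<pi> \<in> \<P> \<Longrightarrow> g \<pi> \<in> \<pi>" "C = \<Inter> (g ` \<P>)"
    by (auto simp: common_refinement)
  with \<open>B \<noteq> C\<close> obtain \<pi> where \<pi>: "\<pi> \<in> \<P>" "f \<pi> \<noteq> g \<pi>"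
    by (metis image_cong)
  then have "disjnt (convex hull f \<pi>) (convex hull g \<pi>)"
    using assms f g by (auto simp: noncrossing_def pairwise_def)
  moreover have "convex hull B \<subseteq> convex hull f \<pi>" "convex hull C \<subseteq> convex hull g \<pi>"
    using \<pi> f g by (auto intro!: hull_mono)
  ultimately show "disjnt (convex hull B) (convex hull C)"
    by (meson disjnt_subset1 disjnt_subset2)
qed

lemma greatest_NC: "greatest (NC P) (if P = {} then {} else {P}) (carrier (NC P))"
  (is "greatest _ ?t _")
proof -
  have t: "partition_on P ?t"
    by (simp add: partition_on_empty partition_on_space)
  moreover have "noncrossing ?t"
    by (simp add: noncrossing_def)
  moreover have "refines P \<pi> ?t" if "partition_on P \<pi>" for \<pi>
  proof (cases "P = {}")
    case True
    with that show ?thesis by (simp add: partition_on_empty refines_def)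
  next
    case False
    have "X \<subseteq> P" if "X \<in> \<pi>" for X
      using that partition_onD1[OF \<open>partition_on P \<pi>\<close>] by blast
    with False that t show ?thesis by (simp add: refines_def)
  qed
  ultimately show ?thesis
    unfolding greatest_def by (simp add: NC_def Ball_def subset_iff)
qed

lemma least_NC: "least (NC P) ((\<lambda>p. {p}) ` P) (carrier (NC P))"
proof -
  have "refines P ((\<lambda>p. {p}) ` P) \<pi>" if "partition_on P \<pi>" for \<pi>
    using that partition_onD1[OF that] by (auto simp: refines_def partition_on_singletons)
  then show ?thesis
    unfolding least_def
    by (auto simp: NC_def noncrossing_def partition_on_singletons pairwise_image pairwise_def)
qed

lemma partial_order_NC: "partial_order (NC P)"
proof
  show "x .=\<^bsub>NC P\<^esub> y"
    if "x \<sqsubseteq>\<^bsub>NC P\<^esub> y" "y \<sqsubseteq>\<^bsub>NC P\<^esub> x" for x y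
    using that refines_asym by (simp add: NC_def)
  show "x \<sqsubseteq>\<^bsub>NC P\<^esub> z"
    if "x \<sqsubseteq>\<^bsub>NC P\<^esub> y" "y \<sqsubseteq>\<^bsub>NC P\<^esub> z" for x y z
    using that refines_trans by (simp add: NC_def)
qed (simp_all add: NC_def refines_refl)

lemma lattice_NC: "lattice (NC P)"
proof -
  interpret partial_order "NC P" by (rule partial_order_NC)
  have inf: "greatest (NC P) (common_refinement S) (Lower (NC P) S)"
    if "S \<subseteq> carrier (NC P)" "S \<noteq> {}" for S
  proof -
    have p: "partition_on P \<pi>" "noncrossing \<pi>" if "\<pi> \<in> S" for \<pi>
      using that \<open>S \<subseteq> _\<close> by (auto simp: NC_def)
    have "common_refinement S \<in> carrier (NC P)"
      using p \<open>S \<noteq> {}\<close>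
      by (auto simp: NC_def intro: partition_on_common_refinement noncrossing_common_refinement)
    then show ?thesis
      using p \<open>S \<noteq> {}\<close> \<open>S \<subseteq> _\<close>
      by (intro greatest_LowerI)
        (auto simp: NC_def Lower_def intro!: refines_common_refinement common_refinement_coarsest)
  qed
  show ?thesis
  proof
    fix a b
    assume ab: "a \<in> carrier (NC P)" "b \<in> carrier (NC P)"
    then show "\<exists>s. greatest (NC P) s (Lower (NC P) {a, b})"
      using inf[of "{a, b}"] by blast
    let ?S = "Upper (NC P) {a, b}"
    have ne: "?S \<noteq> {}"
      using greatest_NC[of P] ab by (auto simp: Upper_def greatest_def)
    have g: "greatest (NC P) (common_refinement ?S) (Lower (NC P) ?S)"
      by (rule inf) (use ne in auto)
    have "least (NC P) (common_refinement ?S) ?S"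
    proof (rule least_UpperI)
      fix z assume "z \<in> {a, b}"
      then show "z \<sqsubseteq>\<^bsub>NC P\<^esub> common_refinement ?S"
        using g ab by (intro greatest_le[OF g]) (auto simp: Lower_def Upper_def)
    next
      fix z assume "z \<in> ?S"
      then show "common_refinement ?S \<sqsubseteq>\<^bsub>NC P\<^esub> z"
        using greatest_Lower_below[OF g] by blast
    qed (use g ab in \<open>auto simp: greatest_def Lower_def\<close>)
    then show "\<exists>s. least (NC P) s (Upper (NC P) {a, b})" ..
  qed
qed

lemma bottom_NC: "\<bottom>\<^bsub>NC P\<^esub> = (\<lambda>p. {p}) ` P"
proof -
  interpret partial_order "NC P" by (rule partial_order_NC)
  show ?thesis
    unfolding bottom_def
    by (rule some_equality[where P = "\<lambda>x. least (NC P) x (carrier (NC P))"])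
      (use least_NC least_unique eq_is_equal in blast)+
qed

lemma top_NC: "\<top>\<^bsub>NC P\<^esub> = (if P = {} then {} else {P})"
proof -
  interpret partial_order "NC P" by (rule partial_order_NC)
  show ?thesis
    unfolding top_def
    by (rule some_equality[where P = "\<lambda>x. greatest (NC P) x (carrier (NC P))"])
      (use greatest_NC greatest_unique eq_is_equal in blast)+
qed

lemma nc_rank_bottom: "nc_rank P \<bottom>\<^bsub>NC P\<^esub> = 0"
  by (simp add: nc_rank_def bottom_NC card_image)

lemma nc_rank_top: "nc_rank P \<top>\<^bsub>NC P\<^esub> = card P - 1"
  by (simp add: nc_rank_def top_NC)

end

theory Submission
  imports Defs
begin

text \<open>The statement holds for every finite set \<open>P\<close> on the two half-axes, by induction on \<open>|P|\<close>.
  Let \<open>p\<close> be the outermost point of one closed half-axis and \<open>q\<close> its neighbour there. The partitions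
  in which \<open>p\<close> is a singleton, or lies in the block of \<open>q\<close>, form a centered copy of the product of
  \<open>NC (P - {p})\<close> with a two-element chain. In each remaining ("loose") partition the other points in
  the block of \<open>p\<close> lie on the other open half-axis. Let \<open>r\<close> be the outermost point there and \<open>r'\<close>
  its neighbour. Either \<open>{p, r}\<close> is a block, giving a centered copy of \<open>NC (P - {p, r})\<close>, or planarity
  forces \<open>r\<close> to be a singleton or to lie in the block of \<open>r'\<close>, giving the product of the loose
  partitions of \<open>P - {r}\<close> with a two-element chain. All pieces have the same centre, and a
  product of a symmetric chain decomposition with a two-element chain is again one.\<close>

section \<open>Symmetric chain decompositions\<close>

text \<open>The finite version, with \<open>k\<close> the prescribed sum of the ranks of the two ends of each chain.\<close>

inductive scd :: "('a \<Rightarrow> 'a \<Rightarrow> bool) \<Rightarrow> ('a \<Rightarrow> nat) \<Rightarrow> nat \<Rightarrow> 'a set \<Rightarrow> bool"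
  for R \<rho> k where
  empty: "scd R \<rho> k {}"
| chain: "scd R \<rho> k S \<Longrightarrow> l \<noteq> [] \<Longrightarrow> set l \<inter> S = {} \<Longrightarrow> successively R l \<Longrightarrow>
    \<rho> (hd l) + \<rho> (last l) = k \<Longrightarrow> scd R \<rho> k (S \<union> set l)"

lemma scd_singleton: "\<rho> a + \<rho> a = k \<Longrightarrow> scd R \<rho> k {a}"
  using scd.chain[OF scd.empty, of "[a]" R \<rho> k] by simp

lemma scd_Un:
  assumes "scd R \<rho> k S" "scd R \<rho> k T" "S \<inter> T = {}"
  shows "scd R \<rho> k (S \<union> T)"
  using assms(2,3)
proof (induction rule: scd.induct)
  case (chain T l)
  then have "scd R \<rho> k ((S \<union> T) \<union> set l)"
    by (intro scd.chain) auto
  then show ?case by (simp add: Un_assoc)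
qed (use assms(1) in simp)

lemma scd_image:
  assumes "scd R \<rho> k S" "inj_on f S"
    and "\<And>a b. a \<in> S \<Longrightarrow> b \<in> S \<Longrightarrow> R a b \<Longrightarrow> R' (f a) (f b)"
    and "\<And>a. a \<in> S \<Longrightarrow> \<rho>' (f a) = \<rho> a + d"
  shows "scd R' \<rho>' (k + 2 * d) (f ` S)"
  using assms
proof (induction rule: scd.induct)
  case (chain S l)
  have "scd R' \<rho>' (k + 2 * d) (f ` S \<union> set (map f l))"
  proof (rule scd.chain)
    show "scd R' \<rho>' (k + 2 * d) (f ` S)"
      using chain by (intro chain.IH) (auto simp: inj_on_Un)
    show "set (map f l) \<inter> f ` S = {}"
      using inj_on_image_Int[OF chain.prems(1), of "set l" S] chain.hyps by simp
    show "successively R' (map f l)"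
      unfolding successively_map
      by (rule successively_mono[OF \<open>successively R l\<close>]) (use chain.prems in auto)
    show "\<rho>' (hd (map f l)) + \<rho>' (last (map f l)) = k + 2 * d"
      using chain.hyps chain.prems(3) by (simp add: hd_map last_map)
  qed (use chain in auto)
  then show ?case by (simp add: image_Un)
qed (simp add: scd.empty)

text \<open>The product with a two-element chain: two copies of a chain \<open>c\<^sub>1, \<dots>, c\<^sub>k\<close> are rearranged into
  \<open>f c\<^sub>1, \<dots>, f c\<^sub>k, g c\<^sub>k\<close> and \<open>g c\<^sub>1, \<dots>, g c\<^sub>k\<^sub>-\<^sub>1\<close>. Here \<open>\<rho>\<close> is decreasing along chains.\<close>

lemma scd_double:
  assumes "scd R \<rho> k S" "inj_on f S" "inj_on g S" "f ` S \<inter> g ` S = {}"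
    and "\<And>a b. a \<in> S \<Longrightarrow> b \<in> S \<Longrightarrow> R a b \<Longrightarrow> \<rho> a = Suc (\<rho> b)"
    and "\<And>a b. a \<in> S \<Longrightarrow> b \<in> S \<Longrightarrow> R a b \<Longrightarrow> R' (f a) (f b)"
    and "\<And>a b. a \<in> S \<Longrightarrow> b \<in> S \<Longrightarrow> R a b \<Longrightarrow> R' (g a) (g b)"
    and "\<And>a. a \<in> S \<Longrightarrow> R' (f a) (g a)"
    and "\<And>a. a \<in> S \<Longrightarrow> \<rho>' (f a) = Suc (\<rho> a)"
    and "\<And>a. a \<in> S \<Longrightarrow> \<rho>' (g a) = \<rho> a"
  shows "scd R' \<rho>' (Suc k) (f ` S \<union> g ` S)"
  using assms
proof (induction rule: scd.induct)
  case (chain S l)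
  note prems = chain.prems
  obtain l' z where l: "l = l' @ [z]"
    using \<open>l \<noteq> []\<close> by (metis append_butlast_last_id)
  let ?A = "f ` S \<union> g ` S" and ?F = "map f l @ [g z]" and ?G = "map g l'"
  \<comment> \<open>\<open>scd\<close> does not ask for distinct lists. The strict drop of
    \<open>\<rho>\<close> along \<open>R\<close> keeps the last entry \<open>z\<close> from
    recurring, so \<open>g z\<close>, the end of \<open>?F\<close>, is not in
    \<open>?G\<close>.\<close>
  have dist: "z \<notin> set l'"
  proof
    assume "z \<in> set l'"
    have "\<rho> z < \<rho> a" if "a \<in> set l'" "set l' \<subseteq> S \<union> set l" "successively R (l' @ [z])" for a l'
      using that
    proof (induction l' arbitrary: a)
      case (Cons b l')
      have "\<rho> (hd (l' @ [z])) < \<rho> b"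
        using Cons.prems prems(4)[of b "hd (l' @ [z])"] l
        by (cases l') (auto simp: successively_Cons)
      moreover have "\<rho> z \<le> \<rho> (hd (l' @ [z]))"
        using Cons.IH[of "hd l'"] Cons.prems by (cases l') (auto simp: less_imp_le)
      ultimately show ?case
        using Cons by (auto simp: successively_Cons split: if_splits)
    qed simp
    then show False
      using \<open>z \<in> set l'\<close> \<open>successively R l\<close> l by fastforce
  qed
  have inj: "f a = f b \<longleftrightarrow> a = b" "g a = g b \<longleftrightarrow> a = b" "f a \<noteq> g b" "g a \<noteq> f b"
    if "a \<in> S \<union> set l" "b \<in> S \<union> set l" for a b
    using that prems(1,2,3) by (auto simp: inj_on_def)
  have sub: "scd R' \<rho>' (Suc k) ?A"
    by (rule chain.IH) (use prems in \<open>auto simp: inj_on_Un\<close>)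
  have succ: "successively R' (map h l)"
    if "\<And>a b. a \<in> S \<union> set l \<Longrightarrow> b \<in> S \<union> set l \<Longrightarrow> R a b \<Longrightarrow> R' (h a) (h b)" for h
    unfolding successively_map
    by (rule successively_mono[OF \<open>successively R l\<close>]) (use that in auto)
  have F: "scd R' \<rho>' (Suc k) (?A \<union> set ?F)"
  proof (rule scd.chain[OF sub])
    show "set ?F \<inter> ?A = {}"
      using inj \<open>set l \<inter> S = {}\<close> l by auto
    show "successively R' ?F"
      using succ[of f] prems(5,7) l by (simp add: successively_append_iff)
    show "\<rho>' (hd ?F) + \<rho>' (last ?F) = Suc k"
      using \<open>\<rho> (hd l) + \<rho> (last l) = k\<close> prems(8,9) l by (cases l') auto
  qed simp
  \<comment> \<open>A one-element chain leaves \<open>?G\<close> empty; an empty list is not a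
    chain, and \<open>?F\<close> alone suffices.\<close>
  have "scd R' \<rho>' (Suc k) (?A \<union> set ?F \<union> set ?G)"
  proof (cases "l' = []")
    case False
    show ?thesis
    proof (rule scd.chain[OF F])
      show "set ?G \<inter> (?A \<union> set ?F) = {}"
        using inj \<open>set l \<inter> S = {}\<close> dist l by auto
      show "successively R' ?G"
        using succ[of g] prems(6) l by (simp add: successively_append_iff)
      \<comment> \<open>\<open>?G\<close> stops one step before the image of \<open>z\<close>, where
        \<open>\<rho>\<close> is larger by one; hence its ends add up to \<open>Suc k\<close> as
        well.\<close>
      have "R (last l') z"
        using \<open>successively R l\<close> False l by (simp add: successively_append_iff)
      then have "\<rho> (last l') = Suc (\<rho> z)"
        using prems(4)[of "last l'" z] False l by simp
      then show "\<rho>' (hd ?G) + \<rho>' (last ?G) = Suc k"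
        using \<open>\<rho> (hd l) + \<rho> (last l) = k\<close> prems(9) False l by (simp add: hd_map last_map)
    qed (use False in simp)
  qed (use F in simp)
  moreover have "?A \<union> set ?F \<union> set ?G = f ` (S \<union> set l) \<union> g ` (S \<union> set l)"
    using l by auto
  ultimately show ?case by simp
qed (simp add: scd.empty)

lemma scd_imp_partition:
  assumes "scd R \<rho> k S"
  shows "\<exists>D. partition_on S D \<and> (\<forall>C\<in>D. \<exists>l. set l = C \<and> l \<noteq> [] \<and> successively R l \<and>
    \<rho> (hd l) + \<rho> (last l) = k)"
  using assms
proof (induction rule: scd.induct)
  case (chain S l)
  then obtain D where D: "partition_on S D" "\<forall>C\<in>D. \<exists>l. set l = C \<and> l \<noteq> [] \<and> successively R l \<and>
    \<rho> (hd l) + \<rho> (last l) = k"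
    by blast
  have "disjnt (set l) (\<Union>D)" "(S \<union> set l) - set l = S"
    using \<open>set l \<inter> S = {}\<close> D(1) by (auto simp: disjnt_def partition_on_def)
  then have "partition_on (S \<union> set l) (insert (set l) D)"
    using D(1) \<open>l \<noteq> []\<close> by (simp add: partition_on_insert)
  then show ?case
    using D(2) chain.hyps by blast
qed (auto simp: partition_on_empty)


section \<open>Refinement and block numbers\<close>

text \<open>One step of a saturated chain, with the number of blocks in place of the rank; a chain is
  centered iff its ends have \<open>card P + 1\<close> blocks in total.\<close>

definition merge_step :: "'a set \<Rightarrow> 'a set set \<Rightarrow> 'a set set \<Rightarrow> bool" where
  "merge_step P \<pi> \<sigma> \<longleftrightarrow> refines P \<pi> \<sigma> \<and> card \<pi> = Suc (card \<sigma>)"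

lemma partition_on_block_eq:
  "partition_on P \<pi> \<Longrightarrow> B \<in> \<pi> \<Longrightarrow> C \<in> \<pi> \<Longrightarrow> z \<in> B \<Longrightarrow> z \<in> C \<Longrightarrow> B = C"
  by (auto simp: partition_on_def disjoint_def)

text \<open>The map \<open>h\<close> from a block of the finer partition to the block containing it
  is onto. The count makes it injective, so a block of \<sigma> holds only one block of \<pi> and
  equals it.\<close>

lemma refines_card_eq:
  assumes "finite P" "refines P \<pi> \<sigma>" "card \<pi> \<le> card \<sigma>"
  shows "\<pi> = \<sigma>"
proof -
  have \<pi>: "partition_on P \<pi>" and \<sigma>: "partition_on P \<sigma>" and sup: "\<forall>B\<in>\<pi>. \<exists>C\<in>\<sigma>. B \<subseteq> C"
    using assms(2) by (auto simp: refines_def)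
  obtain h where h: "\<And>B. B \<in> \<pi> \<Longrightarrow> h B \<in> \<sigma> \<and> B \<subseteq> h B"
    using sup by metis
  have h_eq: "h B = C" if "B \<in> \<pi>" "C \<in> \<sigma>" "z \<in> B" "z \<in> C" for B C z
    using h[OF that(1)] partition_on_block_eq[OF \<sigma>, of "h B" C z] that by blast
  have surj: "h ` \<pi> = \<sigma>"
  proof
    show "\<sigma> \<subseteq> h ` \<pi>"
    proof
      fix C assume C: "C \<in> \<sigma>"
      then obtain z where z: "z \<in> C" "z \<in> P"
        using \<sigma> by (metis Union_iff all_not_in_conv partition_onD1 partition_onD3)
      then obtain B where "B \<in> \<pi>" "z \<in> B"
        using \<pi> by (metis Union_iff partition_onD1)
      then show "C \<in> h ` \<pi>"
        using h_eq C z by blast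
    qed
  qed (use h in blast)
  have fin: "finite \<pi>"
    using assms(1) \<pi> by (rule finite_elements)
  then have inj: "inj_on h \<pi>"
    using assms(3) surj by (metis card_image_le eq_card_imp_inj_on le_antisym)
  have "h B = B" if B: "B \<in> \<pi>" for B
  proof
    show "h B \<subseteq> B"
    proof
      fix z assume z: "z \<in> h B"
      then have "z \<in> P"
        using h[OF B] \<sigma> by (auto simp: partition_on_def)
      then obtain B' where B': "B' \<in> \<pi>" "z \<in> B'"
        using \<pi> by (metis Union_iff partition_onD1)
      then have "h B' = h B"
        using h_eq z h[OF B] by blast
      then show "z \<in> B"
        using inj B B' by (auto simp: inj_on_def)
    qed
  qed (use h[OF B] in blast)
  then show ?thesis
    using surj by auto
qed

lemma carrier_NC: "carrier (NC P) = {\<pi>. partition_on P \<pi> \<and> noncrossing \<pi>}"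
  by (simp add: NC_def)

text \<open>Every proper refinement has strictly more blocks, so a difference of one leaves no room
  for a partition in between.\<close>

lemma merge_step_imp_covers:
  assumes "finite P" "\<pi> \<in> carrier (NC P)" "\<sigma> \<in> carrier (NC P)" "merge_step P \<pi> \<sigma>"
  shows "covers (NC P) \<sigma> \<pi>"
proof -
  have lt: "a \<sqsubset>\<^bsub>NC P\<^esub> b \<longleftrightarrow> refines P a b \<and> a \<noteq> b" for a b
    by (auto simp: lless_def NC_def)
  have less: "card b < card a" if "refines P a b" "a \<noteq> b" for a b
    using refines_card_eq[OF assms(1) that(1)] that(2) by linarith
  have "\<not> (refines P \<pi> z \<and> \<pi> \<noteq> z \<and> refines P z \<sigma> \<and> z \<noteq> \<sigma>)" for z
    using less[of \<pi> z] less[of z \<sigma>] assms(4) unfolding merge_step_def by linarith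
  then show ?thesis
    using assms(2-4) by (auto simp: covers_def lt merge_step_def)
qed

section \<open>Return from block numbers to ranks\<close>

lemma symmetric_chain_decomposition_NC:
  assumes "finite P" "P \<noteq> {}" "scd (merge_step P) card (card P + 1) (carrier (NC P))"
  shows "\<exists>D. symmetric_chain_decomposition (NC P) (nc_rank P) D"
proof -
  obtain D where D: "partition_on (carrier (NC P)) D"
    and ch: "\<And>C. C \<in> D \<Longrightarrow> \<exists>l. set l = C \<and> l \<noteq> [] \<and> successively (merge_step P) l \<and>
      card (hd l) + card (last l) = card P + 1"
    using scd_imp_partition[OF assms(3)] by blast
  have "\<exists>c. set c = C \<and> saturated_chain (NC P) c \<and> centered_chain (NC P) (nc_rank P) c"
    if "C \<in> D" for C
  proof -
    obtain l where l: "set l = C" "l \<noteq> []" "successively (merge_step P) l"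
      "card (hd l) + card (last l) = card P + 1"
      using ch[OF \<open>C \<in> D\<close>] by blast
    have sub: "set l \<subseteq> carrier (NC P)"
      using D l(1) \<open>C \<in> D\<close> by (auto simp: partition_on_def)
    have "successively (\<lambda>a b. covers (NC P) b a) l"
      by (rule successively_mono[OF l(3)]) (use sub merge_step_imp_covers[OF assms(1)] in blast)
    \<comment> \<open>Subtraction in \<open>nc_rank\<close> truncates. This bound makes a total of
      \<open>card P + 1\<close> blocks the same as a rank sum of \<open>card P - 1\<close>.\<close>
    moreover have "card \<pi> \<le> card P" if "\<pi> \<in> set l" for \<pi>
    proof -
      have "refines P ((\<lambda>p. {p}) ` P) \<pi>"
        using least_NC[of P] that sub by (auto simp: least_def NC_def)
      then have "card \<pi> \<le> card ((\<lambda>p. {p}) ` P)"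
        using refines_card_eq[OF assms(1)] by (metis nle_le)
      then show ?thesis by (simp add: card_image)
    qed
    then have "card (hd l) \<le> card P" "card (last l) \<le> card P"
      using l(2) by auto
    ultimately show ?thesis
      using l sub unfolding saturated_chain_def centered_chain_def nc_rank_bottom nc_rank_top
      by (intro exI[of _ l]) (auto simp: nc_rank_def)
  qed
  then show ?thesis
    using D unfolding symmetric_chain_decomposition_def by blast
qed

text \<open>The only partition of the empty set has no blocks, so its one-element chain misses the
  total \<open>card P + 1\<close>. It is centered nevertheless because all ranks are 0.\<close>

lemma symmetric_chain_decomposition_NC_empty:
  "\<exists>D. symmetric_chain_decomposition (NC {}) (nc_rank {}) D"
proof -
  have car: "carrier (NC {}) = {{}}"
    by (auto simp: NC_def partition_on_empty noncrossing_def)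
  show ?thesis
    unfolding symmetric_chain_decomposition_def
    by (intro exI[of _ "{{{}}}"])
      (auto simp: car partition_on_def saturated_chain_def centered_chain_def
        nc_rank_bottom nc_rank_top nc_rank_def intro!: exI[of _ "[{}]"])
qed

section \<open>Points on two perpendicular half-lines\<close>

definition axes :: "complex set" where
  "axes = {z. 0 \<le> Re z \<and> 0 \<le> Im z \<and> Re z * Im z = 0}"

text \<open>Attaching \<open>p\<close> to the block of \<open>q\<close>, or adding it as a singleton, preserves noncrossing partitions.\<close>

definition attachable :: "complex \<Rightarrow> complex \<Rightarrow> complex set \<Rightarrow> bool" where
  "attachable p q P \<longleftrightarrow> q \<in> P \<and> p \<notin> convex hull P \<and>
     (\<forall>B C. B \<subseteq> P \<longrightarrow> C \<subseteq> P \<longrightarrow> q \<in> B \<longrightarrow> disjnt (convex hull B) (convex hull C) \<longrightarrow>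
        disjnt (convex hull (insert p B)) (convex hull C))"

text \<open>\<open>X\<close> and \<open>Y\<close> are the two coordinates in either order. Each
  result is thus proved once and carried to the other half-axis through \<open>swap\<close>.\<close>

locale coordinate_pair =
  fixes X Y :: "complex \<Rightarrow> real"
  assumes coords: "X = Re \<and> Y = Im \<or> X = Im \<and> Y = Re"
begin

lemma swap: "coordinate_pair Y X"
  using coords by unfold_locales auto

lemma linear: "linear X" "linear Y"
  using coords by (auto intro: bounded_linear.linear bounded_linear_Re bounded_linear_Im)

lemmas coord_simps = linear[THEN linear_add] linear[THEN linear_scale]

lemma eqI: "X z = X w \<Longrightarrow> Y z = Y w \<Longrightarrow> z = w"
  using coords by (auto simp: complex_eq_iff)

lemma ex_point: "\<exists>z. X z = a \<and> Y z = b"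
  using coords by (metis complex.sel)

lemma inner_coords: "inner a z = X a * X z + Y a * Y z"
  using coords by (auto simp: inner_complex_def)

lemma axesD: "z \<in> axes \<Longrightarrow> 0 \<le> X z \<and> 0 \<le> Y z \<and> (X z = 0 \<or> Y z = 0)"
  using coords by (auto simp: axes_def)

section \<open>Convex hulls of points on the half-axes\<close>

lemma convex_hull_le:
  assumes "z \<in> convex hull S" "\<And>w. w \<in> S \<Longrightarrow> a * X w + b * Y w \<le> c"
  shows "a * X z + b * Y z \<le> c"
proof -
  obtain u where u: "X u = a" "Y u = b" using ex_point by blast
  have "convex hull S \<subseteq> {w. inner u w \<le> c}"
    by (intro hull_minimal convex_halfspace_le subsetI) (use assms(2) in \<open>auto simp: inner_coords u\<close>)
  then show ?thesis
    using assms(1) by (auto simp: inner_coords u)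
qed

lemma convex_hull_less:
  assumes "z \<in> convex hull S" "\<And>w. w \<in> S \<Longrightarrow> a * X w + b * Y w < c"
  shows "a * X z + b * Y z < c"
proof -
  obtain u where u: "X u = a" "Y u = b" using ex_point by blast
  have "convex hull S \<subseteq> {w. inner u w < c}"
    by (intro hull_minimal convex_halfspace_lt subsetI) (use assms(2) in \<open>auto simp: inner_coords u\<close>)
  then show ?thesis
    using assms(1) by (auto simp: inner_coords u)
qed

text \<open>\<open>X\<close> is nonnegative on \<open>axes\<close>, so the line \<open>X = 0\<close>
  supports the hull and cuts out a face. A face of the hull of a finite set is the hull of a subset
  of that set.\<close>

lemma convex_hull_Int_axis:
  assumes "finite S" "S \<subseteq> axes" "z \<in> convex hull S" "X z = 0"
  shows "z \<in> convex hull {w \<in> S. X w = 0}"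
proof -
  obtain u where u: "X u = 1" "Y u = 0" using ex_point by blast
  have nonneg: "inner u w \<ge> 0" if "w \<in> convex hull S" for w
    using convex_hull_le[OF that, of "-1" 0 0] assms(2) axesD by (auto simp: inner_coords u)
  have "(convex hull S \<inter> {w. inner u w = 0}) face_of (convex hull S)"
    by (rule face_of_Int_supporting_hyperplane_ge) (use nonneg in auto)
  then obtain S' where S': "S' \<subseteq> S" "convex hull S \<inter> {w. inner u w = 0} = convex hull S'"
    using face_of_convex_hull_subset finite_imp_compact[OF assms(1)] by metis
  have "S' \<subseteq> {w. inner u w = 0}"
    using S'(2) hull_subset[of S' convex] by blast
  then have "S' \<subseteq> {w \<in> S. X w = 0}"
    using S'(1) by (auto simp: inner_coords u)
  moreover have "z \<in> convex hull S'"
    using assms(3,4) S'(2) by (auto simp: inner_coords u)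
  ultimately show ?thesis
    using hull_mono by blast
qed

text \<open>If a line separating the hulls of \<open>B\<close> and \<open>C\<close> fails to keep \<open>p\<close> on the side of \<open>B\<close>,
  then it forces all of \<open>C\<close> onto the other axis, where \<open>p\<close> contributes nothing to the hull.\<close>

lemma attachable_outermost:
  assumes P: "finite P" "P \<subseteq> axes"
    and p: "p \<in> axes" "Y p = 0" and q: "q \<in> P" "Y q = 0" "X q < X p"
    and max: "\<And>z. z \<in> P \<Longrightarrow> Y z = 0 \<Longrightarrow> X z \<le> X q"
  shows "attachable p q P"
proof -
  have pos: "0 < X p"
    using q P axesD by (metis le_less_trans subsetD)
  have less: "X z < X p" if "z \<in> P" for z
    using that P axesD[of z] max[of z] q pos by force
  have "p \<notin> convex hull P"
    using convex_hull_less[of p P 1 0 "X p"] less by auto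
  moreover have "disjnt (convex hull (insert p B)) (convex hull C)"
    if B: "B \<subseteq> P" "q \<in> B" and C: "C \<subseteq> P" and BC: "disjnt (convex hull B) (convex hull C)" for B C
  proof -
    have fin: "finite B" "finite C"
      using B C P(1) by (auto intro: finite_subset)
    have "\<exists>a b. (\<forall>x\<in>convex hull B. inner a x < b) \<and> (\<forall>x\<in>convex hull C. inner a x > b)"
      using BC fin
      by (intro separating_hyperplane_compact_closed)
        (use B(2) in \<open>auto simp: disjnt_def finite_imp_compact_convex_hull compact_imp_closed\<close>)
    then obtain a b where a: "\<And>x. x \<in> convex hull B \<Longrightarrow> inner a x < b"
      "\<And>x. x \<in> convex hull C \<Longrightarrow> inner a x > b"
      by blast
    show ?thesis
    proof (cases "inner a p < b")
      case True
      have "X a * X z + Y a * Y z < b" if "z \<in> convex hull (insert p B)" for z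
        using that
        by (rule convex_hull_less) (use True a(1) hull_inc[of _ B] in \<open>auto simp: inner_coords\<close>)
      then show ?thesis
        using a(2) by (fastforce simp: disjnt_iff inner_coords)
    next
      case False
      have aq: "X a * X q < b"
        using a(1)[OF hull_inc[OF B(2)]] q by (simp add: inner_coords)
      with False have "X a * X q < X a * X p"
        using p by (simp add: inner_coords)
      \<comment> \<open>The functional increases from \<open>q\<close> to \<open>p\<close>. A point
        of \<open>C\<close> on their axis lies no further out than \<open>q\<close> and would fall
        on the side of \<open>B\<close>; so \<open>C\<close> avoids that axis.\<close>
      then have "0 < X a"
        using q(3) by (metis less_le_not_le linorder_le_less_linear mult_le_cancel_left)
      have CY: "X z = 0 \<and> Y z \<noteq> 0" if z: "z \<in> C" for z
      proof -
        have "Y z \<noteq> 0"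
        proof
          assume "Y z = 0"
          then have "X a * X z \<le> X a * X q"
            using max z C \<open>0 < X a\<close> by (auto intro: mult_left_mono)
          moreover have "b < X a * X z"
            using a(2)[OF hull_inc[OF z]] \<open>Y z = 0\<close> by (simp add: inner_coords)
          ultimately show False
            using aq by linarith
        qed
        then show ?thesis
          using axesD z C P by blast
      qed
      have "z \<notin> convex hull C" if z: "z \<in> convex hull (insert p B)" for z
      proof
        assume zC: "z \<in> convex hull C"
        have "X z = 0"
          using convex_hull_le[OF zC, of 1 0 0] convex_hull_le[OF zC, of "-1" 0 0] CY by auto
        then have "z \<in> convex hull {w \<in> insert p B. X w = 0}"
          using fin B P p by (intro convex_hull_Int_axis[OF _ _ z]) auto
        moreover have "{w \<in> insert p B. X w = 0} \<subseteq> B"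
          using pos by auto
        ultimately have "z \<in> convex hull B"
          using hull_mono by blast
        then show False
          using BC zC by (auto simp: disjnt_iff)
      qed
      then show ?thesis
        by (auto simp: disjnt_iff)
    qed
  qed
  ultimately show ?thesis
    unfolding attachable_def using q by blast
qed

text \<open>Serves, with \<open>NC_mem_block_of_hull\<close>, to show that a block with two points
  of an axis contains every given point between them.\<close>

lemma between_on_axis:
  assumes "Y a = 0" "Y b = 0" "Y c = 0" "X a \<le> X b" "X b \<le> X c"
  shows "b \<in> convex hull {a, c}"
proof (cases "X a = X c")
  case True
  then have "a = b" using assms by (intro eqI) auto
  then show ?thesis by (simp add: hull_inc)
next
  case False
  define t where "t = (X b - X a) / (X c - X a)"
  have t: "0 \<le> t" "t \<le> 1" using assms False by (auto simp: t_def divide_simps)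
  have "t * (X c - X a) = X b - X a"
    using False by (simp add: t_def)
  then have "b = (1 - t) *\<^sub>R a + t *\<^sub>R c"
    by (intro eqI) (use assms in \<open>auto simp: coord_simps left_diff_distrib right_diff_distrib\<close>)
  then show ?thesis
    using t unfolding convex_hull_2_alt by (force simp: algebra_simps)
qed

text \<open>On one axis \<open>s\<close> is nearer to the origin than \<open>p\<close>, on the other
  \<open>d\<close> is nearer than \<open>r\<close>; segments that join a near point to a far one
  must cross.\<close>

lemma crossing_segments:
  assumes "X r = 0" "X d = 0" "Y s = 0" "Y p = 0"
    and "0 < X s" "X s < X p" "0 < Y d" "Y d < Y r"
  shows "\<exists>z. z \<in> convex hull {s, r} \<and> z \<in> convex hull {p, d}"
proof -
  \<comment> \<open>\<open>D\<close> is the determinant of the equations of the two lines. Cramer's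
    rule gives the barycentric weights \<open>u\<close>, \<open>u'\<close>, \<open>v\<close>,
    \<open>v'\<close> of their common point.\<close>
  define D where "D = Y r * X p - X s * Y d"
  have D: "0 < D"
    using assms mult_strict_mono[of "X s" "X p" "Y d" "Y r"] by (simp add: D_def mult.commute)
  define u where "u = X p * (Y r - Y d) / D"
  define u' where "u' = Y d * (X p - X s) / D"
  define v where "v = X s * (Y r - Y d) / D"
  define v' where "v' = Y r * (X p - X s) / D"
  have nonneg: "0 \<le> u" "0 \<le> u'" "0 \<le> v" "0 \<le> v'"
    using D assms by (simp_all add: u_def u'_def v_def v'_def)
  have "u + u' = D / D" "v + v' = D / D"
    unfolding u_def u'_def v_def v'_def add_divide_distrib[symmetric]
    by (simp_all add: D_def algebra_simps)
  then have sum: "u + u' = 1" "v + v' = 1"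
    using D by simp_all
  have "u *\<^sub>R s + u' *\<^sub>R r = v *\<^sub>R p + v' *\<^sub>R d"
    by (rule eqI) (auto simp: coord_simps assms u_def u'_def v_def v'_def)
  moreover have "u *\<^sub>R s + u' *\<^sub>R r \<in> convex hull {s, r}"
    "v *\<^sub>R p + v' *\<^sub>R d \<in> convex hull {p, d}"
    using nonneg sum by (auto simp: convex_hull_2)
  ultimately show ?thesis by auto
qed

text \<open>The line through \<open>p\<close> and \<open>r\<close> has the equation
  \<open>X z / X p + Y z / Y r = 1\<close>. A point of \<open>Q\<close> has one coordinate zero, so
  it lies strictly on the origin's side.\<close>

lemma outermost_pair_disjnt:
  assumes "Q \<subseteq> axes" "X r = 0" "Y p = 0"
    and "0 < X p" "0 < Y r"
    and "\<And>z. z \<in> Q \<Longrightarrow> X z < X p" "\<And>z. z \<in> Q \<Longrightarrow> Y z < Y r"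
  shows "disjnt (convex hull {p, r}) (convex hull Q)"
proof -
  have "1 / X p * X z + 1 / Y r * Y z < 1" if "z \<in> convex hull Q" for z
    by (rule convex_hull_less[OF that]) (use assms axesD in \<open>force simp: divide_simps\<close>)
  moreover have "- (1 / X p) * X z + - (1 / Y r) * Y z \<le> - 1" if "z \<in> convex hull {p, r}" for z
    by (rule convex_hull_le[OF that]) (use assms in auto)
  ultimately show ?thesis
    by (force simp: disjnt_iff)
qed

end

section \<open>Adding points to noncrossing partitions\<close>

text \<open>An image over all blocks avoids choosing the block of \<open>q\<close>. In a partition
  only that block changes, see \<open>attach_eq_insert\<close>.\<close>

definition attach :: "'a \<Rightarrow> 'a \<Rightarrow> 'a set set \<Rightarrow> 'a set set" where
  "attach p q \<pi> = (\<lambda>B. if q \<in> B then insert p B else B) ` \<pi>"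

lemma attachI: "B \<in> \<pi> \<Longrightarrow> (if q \<in> B then insert p B else B) \<in> attach p q \<pi>"
  unfolding attach_def by (rule imageI)

lemma attachE:
  assumes "C \<in> attach p q \<pi>"
  obtains B where "B \<in> \<pi>" "C = (if q \<in> B then insert p B else B)"
  using assms unfolding attach_def by (rule imageE)

lemma partition_on_block_subset: "partition_on P \<pi> \<Longrightarrow> B \<in> \<pi> \<Longrightarrow> B \<subseteq> P"
  by (auto simp: partition_on_def)

lemma partition_on_ex_block: "partition_on P \<pi> \<Longrightarrow> z \<in> P \<Longrightarrow> \<exists>B\<in>\<pi>. z \<in> B"
  by (auto simp: partition_on_def)

lemma attach_eq_insert:
  assumes "partition_on P \<pi>" "B \<in> \<pi>" "q \<in> B"
  shows "attach p q \<pi> = insert (insert p B) (\<pi> - {B})"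
proof -
  let ?f = "\<lambda>B. if q \<in> B then insert p B else B"
  have "q \<notin> C" if "C \<in> \<pi> - {B}" for C
    using that assms partition_on_block_eq by fastforce
  then have "?f ` (\<pi> - {B}) = (\<lambda>B. B) ` (\<pi> - {B})"
    by (intro image_cong) auto
  moreover have "attach p q \<pi> = ?f ` insert B (\<pi> - {B})"
    using assms(2) by (simp only: attach_def insert_Diff)
  then have "attach p q \<pi> = insert (?f B) (?f ` (\<pi> - {B}))"
    by (simp only: image_insert)
  ultimately show ?thesis
    using assms(3) by (simp only: image_ident if_True)
qed

lemma partition_on_insert_block:
  assumes "partition_on P \<pi>" "B \<inter> P = {}" "B \<noteq> {}"
  shows "partition_on (B \<union> P) (insert B \<pi>)"
proof -
  have "disjnt B (\<Union>\<pi>)" "(B \<union> P) - B = P"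
    using assms by (auto simp: disjnt_def partition_on_def)
  then show ?thesis
    using assms by (simp add: partition_on_insert)
qed

lemma partition_on_remove_block:
  assumes "partition_on P \<pi>" "B \<in> \<pi>"
  shows "partition_on (P - B) (\<pi> - {B})"
proof -
  have "disjnt B (\<Union>(\<pi> - {B}))"
    using assms partition_on_block_eq[OF assms(1)] by (auto simp: disjnt_iff)
  then show ?thesis
    using assms partition_on_insert[of B "\<pi> - {B}" P] by (simp add: insert_absorb)
qed

lemma partition_on_attach:
  assumes "partition_on P \<pi>" "q \<in> P" "p \<notin> P"
  shows "partition_on (insert p P) (attach p q \<pi>)"
proof -
  obtain B where B: "B \<in> \<pi>" "q \<in> B"
    using partition_on_ex_block assms by metis
  have "partition_on (insert p B \<union> (P - B)) (insert (insert p B) (\<pi> - {B}))"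
    using partition_on_remove_block[OF assms(1) B(1)] assms(3)
    by (intro partition_on_insert_block) auto
  moreover have "insert p B \<union> (P - B) = insert p P"
    using partition_on_block_subset[OF assms(1) B(1)] by auto
  ultimately show ?thesis
    using attach_eq_insert[OF assms(1) B] by simp
qed

text \<open>A left inverse of \<open>attach p q\<close>, from which its injectivity follows.\<close>

lemma detach_attach:
  assumes "p \<notin> \<Union>\<pi>"
  shows "(\<lambda>B. B - {p}) ` attach p q \<pi> = \<pi>"
proof -
  have "(\<lambda>B. B - {p}) ` attach p q \<pi> = (\<lambda>B. B) ` \<pi>"
    unfolding attach_def image_image using assms by (intro image_cong) auto
  then show ?thesis by simp
qed

lemma inj_on_attach: "p \<notin> P \<Longrightarrow> inj_on (attach p q) {\<pi>. partition_on P \<pi>}"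
  by (intro inj_on_inverseI[where g = "(`) (\<lambda>B. B - {p})"] detach_attach)
    (simp add: partition_on_def)

lemma card_attach:
  assumes "p \<notin> \<Union>\<pi>"
  shows "card (attach p q \<pi>) = card \<pi>"
  unfolding attach_def
proof (rule card_image, rule inj_onI)
  fix B C
  assume "B \<in> \<pi>" "C \<in> \<pi>"
    and eq: "(if q \<in> B then insert p B else B) = (if q \<in> C then insert p C else C)"
  then have "p \<notin> B" "p \<notin> C"
    using assms by auto
  then show "B = C"
    using eq insert_ident[of p B C] by (cases "q \<in> B"; cases "q \<in> C") auto
qed

lemma refines_insert_block:
  assumes "refines P \<pi> \<sigma>" "B \<inter> P = {}" "B \<noteq> {}"
  shows "refines (B \<union> P) (insert B \<pi>) (insert B \<sigma>)"
  using assms partition_on_insert_block[of P _ B] unfolding refines_def by simp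

lemma refines_attach:
  assumes "refines P \<pi> \<sigma>" "q \<in> P" "p \<notin> P"
  shows "refines (insert p P) (attach p q \<pi>) (attach p q \<sigma>)"
proof -
  have "\<exists>C\<in>attach p q \<sigma>. B \<subseteq> C" if "B \<in> attach p q \<pi>" for B
  proof -
    from that obtain B' where B': "B' \<in> \<pi>" "B = (if q \<in> B' then insert p B' else B')"
      by (rule attachE)
    then obtain C where "C \<in> \<sigma>" "B' \<subseteq> C"
      using assms(1) by (auto simp: refines_def)
    then show ?thesis
      using B' by (intro bexI[OF _ attachI[of C]]) auto
  qed
  then show ?thesis
    using assms partition_on_attach[of P _ q p] unfolding refines_def by simp
qed

lemma refines_singleton_attach:
  assumes "partition_on P \<pi>" "q \<in> P" "p \<notin> P"
  shows "refines (insert p P) (insert {p} \<pi>) (attach p q \<pi>)"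
proof -
  have "\<exists>C\<in>attach p q \<pi>. B \<subseteq> C" if "B \<in> insert {p} \<pi>" for B
    using that
  proof
    assume "B = {p}"
    moreover obtain C where "C \<in> \<pi>" "q \<in> C"
      using partition_on_ex_block[OF assms(1,2)] by blast
    ultimately show ?thesis
      by (intro bexI[OF _ attachI[of C]]) auto
  next
    assume "B \<in> \<pi>"
    then show ?thesis
      by (intro bexI[OF _ attachI[of B]]) auto
  qed
  then show ?thesis
    using assms partition_on_attach[of P \<pi> q p] partition_on_insert_block[of P \<pi> "{p}"]
    unfolding refines_def by simp
qed

section \<open>Noncrossing partitions under insertion and removal\<close>

lemma noncrossing_insert:
  "noncrossing (insert B \<pi>) \<longleftrightarrow> noncrossing \<pi> \<and>
     (\<forall>C\<in>\<pi>. C \<noteq> B \<longrightarrow> disjnt (convex hull B) (convex hull C))"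
  unfolding noncrossing_def by (auto simp: pairwise_insert disjnt_sym)

lemma noncrossing_subset: "noncrossing \<pi> \<Longrightarrow> \<sigma> \<subseteq> \<pi> \<Longrightarrow> noncrossing \<sigma>"
  unfolding noncrossing_def by (rule pairwise_subset)

lemma NC_block_eq:
  assumes "\<pi> \<in> carrier (NC P)" "B \<in> \<pi>" "C \<in> \<pi>" "z \<in> convex hull B" "z \<in> convex hull C"
  shows "B = C"
  using assms by (auto simp: carrier_NC noncrossing_def pairwise_def disjnt_iff)

text \<open>The hull of the block of \<open>z\<close> meets the hull of \<open>B\<close> in
  \<open>z\<close>, and distinct blocks of a noncrossing partition have disjoint hulls.\<close>

lemma NC_mem_block_of_hull:
  assumes "\<pi> \<in> carrier (NC P)" "B \<in> \<pi>" "S \<subseteq> B" "z \<in> convex hull S" "z \<in> P"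
  shows "z \<in> B"
proof -
  obtain C where C: "C \<in> \<pi>" "z \<in> C"
    using partition_on_ex_block[of P \<pi> z] assms(1,5) by (auto simp: carrier_NC)
  have "z \<in> convex hull B"
    using hull_mono[OF assms(3)] assms(4) by blast
  then show ?thesis
    using NC_block_eq[OF assms(1,2) C(1)] hull_inc[OF C(2)] C(2) by blast
qed

lemma insert_block_in_NC:
  assumes "\<pi> \<in> carrier (NC P)" "B \<noteq> {}" "disjnt (convex hull B) (convex hull P)"
  shows "insert B \<pi> \<in> carrier (NC (B \<union> P))"
proof -
  have "B \<inter> P = {}"
    using assms(3) hull_subset[of B convex] hull_subset[of P convex] by (auto simp: disjnt_iff)
  moreover have "disjnt (convex hull B) (convex hull C)" if "C \<in> \<pi>" for C
    using hull_mono[of C P convex] partition_on_block_subset[of P \<pi> C] that assms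
    by (auto simp: carrier_NC disjnt_iff)
  ultimately show ?thesis
    using assms by (simp add: carrier_NC noncrossing_insert partition_on_insert_block)
qed

lemma attachable_notin: "attachable p q P \<Longrightarrow> p \<notin> P"
  unfolding attachable_def using hull_inc by metis

lemma singleton_in_NC:
  assumes "attachable p q P" "\<pi> \<in> carrier (NC P)"
  shows "insert {p} \<pi> \<in> carrier (NC (insert p P))"
  using insert_block_in_NC[OF assms(2), of "{p}"] assms(1) by (simp add: attachable_def)

lemma attach_in_NC:
  assumes "attachable p q P" "\<pi> \<in> carrier (NC P)"
  shows "attach p q \<pi> \<in> carrier (NC (insert p P))"
proof -
  have \<pi>: "partition_on P \<pi>" "noncrossing \<pi>" and q: "q \<in> P"
    using assms by (auto simp: carrier_NC attachable_def)
  obtain B where B: "B \<in> \<pi>" "q \<in> B"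
    using partition_on_ex_block[OF \<pi>(1) q] by blast
  have "disjnt (convex hull insert p B) (convex hull C)" if "C \<in> \<pi> - {B}" for C
  proof -
    have "disjnt (convex hull B) (convex hull C)"
      using \<pi>(2) B that by (auto simp: noncrossing_def pairwise_def)
    then show ?thesis
      using assms(1) B that partition_on_block_subset[OF \<pi>(1)] by (auto simp: attachable_def)
  qed
  then have "noncrossing (attach p q \<pi>)"
    unfolding attach_eq_insert[OF \<pi>(1) B] noncrossing_insert
    using noncrossing_subset[OF \<pi>(2)] by auto
  then show ?thesis
    using partition_on_attach[OF \<pi>(1) q attachable_notin[OF assms(1)]] by (simp add: carrier_NC)
qed

lemma remove_block_in_NC:
  assumes "\<pi> \<in> carrier (NC P)" "B \<in> \<pi>"
  shows "\<pi> - {B} \<in> carrier (NC (P - B))"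
  using assms by (auto simp: carrier_NC intro: partition_on_remove_block noncrossing_subset)

text \<open>Deleting a point shrinks the hull of its block, so no crossing arises. As
  \<open>q\<close> stays behind, the block remains nonempty and \<open>attach\<close> can find it
  again.\<close>

lemma detach_in_NC:
  assumes "\<pi> \<in> carrier (NC P)" "B \<in> \<pi>" "p \<in> B" "q \<in> B" "p \<noteq> q"
  shows "insert (B - {p}) (\<pi> - {B}) \<in> carrier (NC (P - {p}))"
    and "\<pi> = attach p q (insert (B - {p}) (\<pi> - {B}))"
proof -
  let ?\<sigma> = "insert (B - {p}) (\<pi> - {B})"
  have \<pi>: "partition_on P \<pi>" "noncrossing \<pi>"
    using assms by (auto simp: carrier_NC)
  have "partition_on ((B - {p}) \<union> (P - B)) ?\<sigma>"
    by (rule partition_on_insert_block[OF partition_on_remove_block[OF \<pi>(1) assms(2)]])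
      (use assms in auto)
  moreover have "(B - {p}) \<union> (P - B) = P - {p}"
    using partition_on_block_subset[OF \<pi>(1) assms(2)] assms(3) by blast
  ultimately have part: "partition_on (P - {p}) ?\<sigma>"
    by simp
  have "disjnt (convex hull (B - {p})) (convex hull C)" if "C \<in> \<pi> - {B}" for C
  proof (rule disjnt_subset1)
    show "disjnt (convex hull B) (convex hull C)"
      using \<pi>(2) assms(2) that by (auto simp: noncrossing_def pairwise_def)
    show "convex hull (B - {p}) \<subseteq> convex hull B"
      by (intro hull_mono) auto
  qed
  then have "noncrossing ?\<sigma>"
    unfolding noncrossing_insert using noncrossing_subset[OF \<pi>(2)] by blast
  then show "?\<sigma> \<in> carrier (NC (P - {p}))"
    using part by (simp add: carrier_NC)
  \<comment> \<open>Another block \<open>B - {p}\<close> would share \<open>q\<close> with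
    \<open>B\<close>. Hence inserting it adds a new block, and removing that block gives back
    \<open>\<pi> - {B}\<close>.\<close>
  have "B - {p} \<notin> \<pi> - {B}"
    using partition_on_block_eq[OF \<pi>(1), of B "B - {p}" q] assms by auto
  then show "\<pi> = attach p q ?\<sigma>"
    using attach_eq_insert[OF part, of "B - {p}" q p] assms by (auto simp: insert_absorb)
qed

section \<open>Chain decompositions of the enlarged families\<close>

lemma scd_insert_block:
  assumes "scd (merge_step P) card k S" "S \<subseteq> carrier (NC P)" "finite P" "B \<inter> P = {}" "B \<noteq> {}"
  shows "scd (merge_step (B \<union> P)) card (k + 2) (insert B ` S)"
proof -
  have notin: "B \<notin> \<pi>" and fin: "finite \<pi>" if "\<pi> \<in> S" for \<pi>
  proof -
    have \<pi>: "partition_on P \<pi>"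
      using that assms(2) by (auto simp: carrier_NC)
    show "finite \<pi>"
      using assms(3) \<pi> by (rule finite_elements)
    show "B \<notin> \<pi>"
      using partition_on_block_subset[OF \<pi>] assms(4,5) by blast
  qed
  \<comment> \<open>Each partition gains the one block \<open>B\<close>, so the two ends of a chain
    together gain 2.\<close>
  have "scd (merge_step (B \<union> P)) card (k + 2 * 1) (insert B ` S)"
    using assms(1)
  proof (rule scd_image)
    show "inj_on (insert B) S"
      using notin by (auto simp: inj_on_def insert_ident)
  qed (use notin fin assms in \<open>auto simp: merge_step_def refines_insert_block\<close>)
  then show ?thesis by simp
qed

text \<open>\<open>scd_double\<close> applies with \<open>card\<close> as the decreasing rank: the
  singleton \<open>{p}\<close> adds a block, attaching adds none and gives a coarser partition.
  \<open>S\<close> is left arbitrary because the loose partitions need this too.\<close>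

lemma scd_attach:
  assumes "scd (merge_step P) card k S" "S \<subseteq> carrier (NC P)" "finite P" "q \<in> P" "p \<notin> P"
  shows "scd (merge_step (insert p P)) card (Suc k) (insert {p} ` S \<union> attach p q ` S)"
proof -
  have part: "partition_on P \<pi>" and notin: "p \<notin> \<Union>\<pi>" "{p} \<notin> \<pi>" and fin: "finite \<pi>"
    if "\<pi> \<in> S" for \<pi>
  proof -
    show \<pi>: "partition_on P \<pi>"
      using that assms(2) by (auto simp: carrier_NC)
    show "finite \<pi>"
      using assms(3) \<pi> by (rule finite_elements)
    show "p \<notin> \<Union>\<pi>" "{p} \<notin> \<pi>"
      using \<pi> assms(5) by (auto simp: partition_on_def)
  qed
  have "{p} \<notin> attach p q \<pi>" if "\<pi> \<in> S" for \<pi>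
    using notin[OF that] assms(4,5) by (auto elim!: attachE split: if_splits)
  then have disj: "insert {p} ` S \<inter> attach p q ` S = {}"
    by auto
  show ?thesis
    using assms(1)
  proof (rule scd_double)
    show "inj_on (insert {p}) S"
      using notin by (auto simp: inj_on_def insert_ident)
    show "inj_on (attach p q) S"
      by (rule inj_on_subset[OF inj_on_attach[OF assms(5), of q]]) (use part in auto)
    show "merge_step (insert p P) (insert {p} a) (insert {p} b)"
      if "a \<in> S" "b \<in> S" "merge_step P a b" for a b
      using that notin fin assms(5) refines_insert_block[of P a b "{p}"]
      by (auto simp: merge_step_def)
    show "merge_step (insert p P) (attach p q a) (attach p q b)"
      if "a \<in> S" "b \<in> S" "merge_step P a b" for a b
      using that notin assms refines_attach[of P a b q p]
      by (auto simp: merge_step_def card_attach)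
    show "merge_step (insert p P) (insert {p} a) (attach p q a)" if "a \<in> S" for a
      using notin[OF that] fin[OF that] refines_singleton_attach[OF part[OF that] assms(4,5)]
      by (simp add: merge_step_def card_attach)
  qed (use notin fin disj in \<open>auto simp: merge_step_def card_attach\<close>)
qed

text \<open>Used with \<open>p\<close> the outermost point of an axis and \<open>q\<close> its neighbour on that axis.\<close>

definition loose :: "complex set \<Rightarrow> complex \<Rightarrow> complex \<Rightarrow> complex set set set" where
  "loose P p q = {\<pi> \<in> carrier (NC P). {p} \<notin> \<pi> \<and> (\<forall>B\<in>\<pi>. p \<in> B \<longrightarrow> q \<notin> B)}"

text \<open>Either \<open>p\<close> is alone, or it shares a block with \<open>q\<close>, or
  neither. In the first two cases deleting \<open>p\<close> recovers the partition of
  \<open>P\<close>.\<close>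

lemma NC_attach_decomposition:
  assumes "attachable p q P"
  shows "carrier (NC (insert p P)) =
    (insert {p} ` carrier (NC P) \<union> attach p q ` carrier (NC P)) \<union> loose (insert p P) p q"
    (is "_ = (?A \<union> ?B) \<union> ?L")
    and "(insert {p} ` carrier (NC P) \<union> attach p q ` carrier (NC P)) \<inter> loose (insert p P) p q = {}"
proof -
  have p: "p \<notin> P" and q: "q \<in> P"
    using attachable_notin[OF assms] assms by (simp_all add: attachable_def)
  have rem: "insert p P - {p} = P"
    using p by auto
  show "carrier (NC (insert p P)) = (?A \<union> ?B) \<union> ?L"
  proof
    show "carrier (NC (insert p P)) \<subseteq> (?A \<union> ?B) \<union> ?L"
    proof
      fix \<pi> assume \<pi>: "\<pi> \<in> carrier (NC (insert p P))"
      show "\<pi> \<in> (?A \<union> ?B) \<union> ?L"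
      proof (cases "{p} \<in> \<pi>")
        case True
        then have "\<pi> = insert {p} (\<pi> - {{p}})" by auto
        moreover have "\<pi> - {{p}} \<in> carrier (NC P)"
          using remove_block_in_NC[OF \<pi> True] by (simp only: rem)
        ultimately show ?thesis by blast
      next
        case False
        show ?thesis
        proof (cases "\<exists>B\<in>\<pi>. p \<in> B \<and> q \<in> B")
          case True
          then obtain B where B: "B \<in> \<pi>" "p \<in> B" "q \<in> B" by blast
          have "p \<noteq> q"
            using p q by blast
          note det = detach_in_NC[OF \<pi> B this]
          have "insert (B - {p}) (\<pi> - {B}) \<in> carrier (NC P)"
            using det(1) by (simp only: rem)
          then show ?thesis
            using det(2) by blast
        next
          case False
          then show ?thesis
            using \<pi> \<open>{p} \<notin> \<pi>\<close> by (auto simp: loose_def)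
        qed
      qed
    qed
    show "(?A \<union> ?B) \<union> ?L \<subseteq> carrier (NC (insert p P))"
      using singleton_in_NC[OF assms] attach_in_NC[OF assms] by (auto simp: loose_def)
  qed
  have "\<exists>B\<in>attach p q \<pi>. p \<in> B \<and> q \<in> B" if "\<pi> \<in> carrier (NC P)" for \<pi>
  proof -
    obtain B where "B \<in> \<pi>" "q \<in> B"
      using partition_on_ex_block[of P \<pi> q] q \<open>\<pi> \<in> carrier (NC P)\<close> by (auto simp: carrier_NC)
    then show ?thesis
      by (intro bexI[OF _ attachI[of B]]) auto
  qed
  then show "(?A \<union> ?B) \<inter> ?L = {}"
    unfolding loose_def by blast
qed

lemma scd_NC_insert:
  assumes "attachable p q P" "finite P"
    and "scd (merge_step P) card (card P + 1) (carrier (NC P))"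
    and "scd (merge_step (insert p P)) card (card (insert p P) + 1) (loose (insert p P) p q)"
  shows "scd (merge_step (insert p P)) card (card (insert p P) + 1) (carrier (NC (insert p P)))"
proof -
  have p: "p \<notin> P" "q \<in> P"
    using attachable_notin[OF assms(1)] assms(1) by (simp_all add: attachable_def)
  have "scd (merge_step (insert p P)) card (card (insert p P) + 1)
    (insert {p} ` carrier (NC P) \<union> attach p q ` carrier (NC P))"
    using scd_attach[OF assms(3) _ assms(2) p(2,1)] assms(2) p by simp
  then show ?thesis
    using scd_Un[OF _ assms(4)] NC_attach_decomposition[OF assms(1)] by simp
qed

section \<open>Partitions loose at an outermost point\<close>

lemma ex_max_on:
  fixes f :: "'a \<Rightarrow> real"
  assumes "finite A" "A \<noteq> {}"
  shows "\<exists>m\<in>A. \<forall>z\<in>A. f z \<le> f m"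
proof -
  have "Max (f ` A) \<in> f ` A"
    using assms by simp
  then obtain m where "m \<in> A" "f m = Max (f ` A)"
    by (metis imageE)
  then show ?thesis
    using assms by (metis Max_ge finite_imageI imageI)
qed

text \<open>\<open>q\<close> is the neighbour of \<open>p\<close> on the axis of \<open>X\<close>,
  and may be the origin. The assumptions survive the removal of any point other than
  \<open>p\<close> and \<open>q\<close>, as the induction in \<open>scd_loose\<close>
  requires.\<close>

locale outermost_point = coordinate_pair +
  fixes P p q
  assumes finite: "finite P" and axes: "P \<subseteq> axes"
    and p: "p \<in> P" "Y p = 0" and q: "q \<in> P" "Y q = 0" "X q < X p"
    and max: "\<And>z. z \<in> P \<Longrightarrow> z \<noteq> p \<Longrightarrow> Y z = 0 \<Longrightarrow> X z \<le> X q"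
begin

lemma pos: "0 < X p"
  using q axes axesD by (metis le_less_trans subsetD)

lemma X_less: "z \<in> P \<Longrightarrow> z \<noteq> p \<Longrightarrow> X z < X p"
  using axes axesD[of z] max[of z] q pos by force

text \<open>If \<open>s\<close> were on the axis of \<open>p\<close>, the segment from
  \<open>s\<close> to \<open>p\<close> would contain \<open>q\<close> and pull it into the block,
  contrary to looseness.\<close>

lemma loose_block:
  assumes "\<pi> \<in> loose P p q" "D \<in> \<pi>" "p \<in> D" "s \<in> D" "s \<noteq> p"
  shows "X s = 0" "0 < Y s"
proof -
  have \<pi>: "\<pi> \<in> carrier (NC P)" and "q \<notin> D"
    using assms by (auto simp: loose_def)
  then have s: "s \<in> P" "s \<noteq> q"
    using partition_on_block_subset[of P \<pi> D] assms by (auto simp: carrier_NC)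
  have "Y s \<noteq> 0"
  proof
    assume "Y s = 0"
    then have "q \<in> convex hull {s, p}"
      using max[OF s(1) assms(5)] p q by (intro between_on_axis) auto
    then show False
      using NC_mem_block_of_hull[OF \<pi> assms(2) _ _ q(1), of "{s, p}"] assms(3,4) \<open>q \<notin> D\<close>
      by simp
  qed
  then show "X s = 0" "0 < Y s"
    using axesD[of s] s axes by auto
qed

text \<open>If \<open>r\<close> shared its block only with points of the axis of \<open>p\<close>, a segment of that block would cross
  a segment of the block of \<open>p\<close>.\<close>

lemma loose_other_block:
  assumes \<pi>: "\<pi> \<in> loose P p q" and "{p, r} \<notin> \<pi>" "E \<in> \<pi>" "r \<in> E" "E \<noteq> {r}"
    and r: "r \<in> P" "X r = 0" and r_max: "\<And>z. z \<in> P \<Longrightarrow> X z = 0 \<Longrightarrow> Y z \<le> Y r"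
  shows "\<exists>s\<in>E. s \<noteq> r \<and> X s = 0"
proof -
  have NC: "\<pi> \<in> carrier (NC P)" and part: "partition_on P \<pi>" and "{p} \<notin> \<pi>"
    using \<pi> by (auto simp: loose_def carrier_NC)
  obtain D where D: "D \<in> \<pi>" "p \<in> D"
    using partition_on_ex_block[OF part p(1)] by blast
  show ?thesis
  proof (cases "D = E")
    case True
    \<comment> \<open>Here \<open>p\<close> and \<open>r\<close> share a block that is not the pair,
      so it has a third point, on the other axis by \<open>loose_block\<close>.\<close>
    have "E \<noteq> {p, r}"
      using assms(2,3) by blast
    then have "\<exists>s\<in>E. s \<noteq> p \<and> s \<noteq> r"
      using D(2) assms(4) True by blast
    then show ?thesis
      using loose_block[OF \<pi> D] True by blast
  next
    case False
    obtain s where s: "s \<in> E" "s \<noteq> r"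
      using assms by blast
    have "p \<notin> E"
      using partition_on_block_eq[OF part D(1) assms(3)] D(2) False by blast
    then have sP: "s \<in> P" "s \<noteq> p"
      using s partition_on_block_subset[OF part assms(3)] by auto
    have "D \<noteq> {p}"
      using D \<open>{p} \<notin> \<pi>\<close> by blast
    then obtain d where d: "d \<in> D" "d \<noteq> p"
      using D(2) by blast
    have "d \<noteq> r" "d \<in> P"
      using partition_on_block_eq[OF part D(1) assms(3)] d assms(4) False
        partition_on_block_subset[OF part D(1)] by auto
    have "X d = 0" "0 < Y d"
      using loose_block[OF \<pi> D d] by auto
    then have "Y d < Y r"
      using r_max[OF \<open>d \<in> P\<close>] r(2) eqI[of d r] \<open>d \<noteq> r\<close> by fastforce
    have "X s = 0"
    proof (rule ccontr)
      assume "X s \<noteq> 0"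
      then have "Y s = 0" "0 < X s"
        using axesD[of s] sP axes by auto
      then obtain z where z: "z \<in> convex hull {s, r}" "z \<in> convex hull {p, d}"
        using crossing_segments[of r d s p] X_less[OF sP] p r \<open>X d = 0\<close> \<open>0 < Y d\<close> \<open>Y d < Y r\<close>
        by blast
      have "convex hull {s, r} \<subseteq> convex hull E" "convex hull {p, d} \<subseteq> convex hull D"
        using s assms D d by (auto intro!: hull_mono)
      then show False
        using NC_block_eq[OF NC D(1) assms(3)] z False by blast
    qed
    then show ?thesis
      using s by blast
  qed
qed

text \<open>All other points lie strictly on the origin's side of the line through \<open>p\<close>
  and \<open>r\<close>, so the block \<open>{p, r}\<close> crosses nothing in any partition of the
  rest.\<close>

lemma loose_outermost_pair:
  assumes r: "r \<in> P" "X r = 0" "0 < Y r"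
    and r_max: "\<And>z. z \<in> P \<Longrightarrow> X z = 0 \<Longrightarrow> Y z \<le> Y r"
  shows "{\<pi> \<in> loose P p q. {p, r} \<in> \<pi>} = insert {p, r} ` carrier (NC (P - {p, r}))"
proof -
  have pr: "p \<noteq> r" and qr: "q \<noteq> r" "q \<noteq> p"
    using pos r q by auto
  have Y_less: "Y z < Y r" if "z \<in> P" "z \<noteq> r" for z
    using that axes axesD[of z] r_max[of z] r eqI[of z r] by force
  have disj: "disjnt (convex hull {p, r}) (convex hull (P - {p, r}))"
    by (rule outermost_pair_disjnt) (use axes r p pos X_less Y_less in auto)
  have un: "{p, r} \<union> (P - {p, r}) = P"
    using p r by auto
  show ?thesis
  proof
    show "{\<pi> \<in> loose P p q. {p, r} \<in> \<pi>} \<subseteq> insert {p, r} ` carrier (NC (P - {p, r}))"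
    proof
      fix \<pi> assume "\<pi> \<in> {\<pi> \<in> loose P p q. {p, r} \<in> \<pi>}"
      then have "\<pi> = insert {p, r} (\<pi> - {{p, r}})" "\<pi> - {{p, r}} \<in> carrier (NC (P - {p, r}))"
        using remove_block_in_NC[of \<pi> P "{p, r}"] by (auto simp: loose_def)
      then show "\<pi> \<in> insert {p, r} ` carrier (NC (P - {p, r}))"
        by blast
    qed
    show "insert {p, r} ` carrier (NC (P - {p, r})) \<subseteq> {\<pi> \<in> loose P p q. {p, r} \<in> \<pi>}"
    proof
      fix \<pi> assume "\<pi> \<in> insert {p, r} ` carrier (NC (P - {p, r}))"
      then obtain \<sigma> where \<sigma>: "\<sigma> \<in> carrier (NC (P - {p, r}))" "\<pi> = insert {p, r} \<sigma>"
        by blast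
      have "\<pi> \<in> carrier (NC P)"
        using insert_block_in_NC[OF \<sigma>(1) _ disj] un \<sigma>(2) by simp
      moreover have "p \<notin> B" if "B \<in> \<sigma>" for B
        using partition_on_block_subset[of "P - {p, r}" \<sigma> B] \<sigma>(1) that by (auto simp: carrier_NC)
      ultimately show "\<pi> \<in> {\<pi> \<in> loose P p q. {p, r} \<in> \<pi>}"
        using \<sigma>(2) pr qr by (auto simp: loose_def)
    qed
  qed
qed

text \<open>If \<open>r\<close> is not alone, \<open>loose_other_block\<close> puts another point of
  its axis in its block; \<open>r'\<close> lies between that point and \<open>r\<close>, hence in
  the block too.\<close>

lemma loose_attach_decomposition:
  assumes r: "r \<in> P" "X r = 0" "r' \<in> P" "X r' = 0" "Y r' < Y r"
    and r_max: "\<And>z. z \<in> P \<Longrightarrow> z \<noteq> r \<Longrightarrow> X z = 0 \<Longrightarrow> Y z \<le> Y r'"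
  shows "{\<pi> \<in> loose P p q. {p, r} \<notin> \<pi>} =
      insert {r} ` loose (P - {r}) p q \<union> attach r r' ` loose (P - {r}) p q"
proof -
  have pr: "p \<noteq> r" and qr: "q \<noteq> r" and r'r: "r' \<noteq> r"
    using pos r q axesD axes p by force+
  have att: "attachable r r' (P - {r})"
    by (rule coordinate_pair.attachable_outermost[OF swap])
      (use finite axes r r'r r_max in auto)
  have r_max': "Y z \<le> Y r" if "z \<in> P" "X z = 0" for z
    using r_max[OF that(1) _ that(2)] r(5) by (cases "z = r") auto
  have ins: "insert r (P - {r}) = P"
    using r by auto
  show "{\<pi> \<in> loose P p q. {p, r} \<notin> \<pi>} =
      insert {r} ` loose (P - {r}) p q \<union> attach r r' ` loose (P - {r}) p q" (is "?L = ?A \<union> ?B")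
  proof
    show "?L \<subseteq> ?A \<union> ?B"
    proof
      fix \<pi> assume "\<pi> \<in> ?L"
      then have \<pi>: "\<pi> \<in> loose P p q" "{p, r} \<notin> \<pi>" and NC: "\<pi> \<in> carrier (NC P)"
        and part: "partition_on P \<pi>" and np: "{p} \<notin> \<pi>" "\<And>B. B \<in> \<pi> \<Longrightarrow> p \<in> B \<Longrightarrow> q \<notin> B"
        by (auto simp: loose_def carrier_NC)
      obtain E where E: "E \<in> \<pi>" "r \<in> E"
        using partition_on_ex_block[OF part r(1)] by blast
      show "\<pi> \<in> ?A \<union> ?B"
      proof (cases "E = {r}")
        case True
        have "\<pi> - {{r}} \<in> loose (P - {r}) p q"
          using remove_block_in_NC[OF NC, of "{r}"] E True np by (auto simp: loose_def)
        moreover have "\<pi> = insert {r} (\<pi> - {{r}})"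
          using E True by auto
        ultimately show ?thesis by blast
      next
        case False
        obtain s where s: "s \<in> E" "s \<noteq> r" "X s = 0"
          using loose_other_block[OF \<pi> E False r(1,2) r_max'] by blast
        have "s \<in> P"
          using s(1) partition_on_block_subset[OF part E(1)] by blast
        then have "r' \<in> convex hull {s, r}"
          using r_max[OF _ s(2,3)] s r
          by (intro coordinate_pair.between_on_axis[OF swap]) auto
        then have r'E: "r' \<in> E"
          using NC_mem_block_of_hull[OF NC E(1) _ _ r(3), of "{s, r}"] s(1) E(2) by simp
        let ?\<sigma> = "insert (E - {r}) (\<pi> - {E})"
        note det = detach_in_NC[OF NC E r'E r'r[symmetric]]
        \<comment> \<open>Deleting \<open>r\<close> must not leave \<open>p\<close> alone; this is
          where the pair \<open>{p, r}\<close> had to be set aside.\<close>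
        have "E - {r} \<noteq> {p}"
          using \<pi>(2) E by (metis insert_Diff insert_commute)
        moreover have "q \<notin> E - {r}" if "p \<in> E - {r}"
          using np(2)[OF E(1)] that by blast
        ultimately have "?\<sigma> \<in> loose (P - {r}) p q"
          using det(1) np unfolding loose_def by blast
        then show ?thesis
          using det(2) by blast
      qed
    qed
    have "\<pi> \<in> ?L" if \<sigma>: "\<sigma> \<in> loose (P - {r}) p q" and "\<pi> = insert {r} \<sigma> \<or> \<pi> = attach r r' \<sigma>"
      for \<pi> \<sigma>
    proof -
      have NC: "\<sigma> \<in> carrier (NC (P - {r}))"
        and np: "{p} \<notin> \<sigma>" "\<And>B. B \<in> \<sigma> \<Longrightarrow> p \<in> B \<Longrightarrow> q \<notin> B"
        using \<sigma> by (auto simp: loose_def)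
      have nr: "r \<notin> B" if "B \<in> \<sigma>" for B
        using partition_on_block_subset[of "P - {r}" \<sigma> B] NC that by (auto simp: carrier_NC)
      from that(2) show ?thesis
      proof
        assume \<pi>: "\<pi> = insert {r} \<sigma>"
        have "\<pi> \<in> carrier (NC P)"
          using singleton_in_NC[OF att NC] ins \<pi> by simp
        then show ?thesis
          using \<pi> np nr pr by (auto simp: loose_def)
      next
        assume \<pi>: "\<pi> = attach r r' \<sigma>"
        have "\<pi> \<in> carrier (NC P)"
          using attach_in_NC[OF att NC] ins \<pi> by simp
        \<comment> \<open>Conversely, attaching \<open>r\<close> yields \<open>{p, r}\<close> only
          from a block \<open>{p}\<close>, which a loose partition lacks.\<close>
        moreover have "B \<noteq> {p} \<and> B \<noteq> {p, r} \<and> (p \<in> B \<longrightarrow> q \<notin> B)" if "B \<in> \<pi>" for B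
        proof -
          obtain B' where B': "B' \<in> \<sigma>" "B = (if r' \<in> B' then insert r B' else B')"
            using \<open>B \<in> \<pi>\<close> unfolding \<pi> by (rule attachE)
          have "B' \<noteq> {p}" "r \<notin> B'" "p \<in> B' \<longrightarrow> q \<notin> B'"
            using np nr B'(1) by auto
          then have "B \<noteq> {p}" "B \<noteq> {p, r}" "p \<in> B \<longrightarrow> q \<notin> B"
            using B'(2) pr qr by (auto split: if_splits)
          then show ?thesis by blast
        qed
        ultimately show ?thesis
          unfolding loose_def by blast
      qed
    qed
    then show "?A \<union> ?B \<subseteq> ?L" by blast
  qed
qed

end

section \<open>Induction over the points of the other half-axis\<close>

context coordinate_pair
begin

text \<open>The points \<open>p\<close> and \<open>q\<close> stay fixed while the induction removes
  the outermost point \<open>r\<close> of the other axis. The hypothesis on smaller sets supplies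
  the partitions with block \<open>{p, r}\<close>, which come from all of
  \<open>NC (P - {p, r})\<close>.\<close>

lemma scd_loose:
  assumes "outermost_point X Y P p q"
    and "\<And>Q. Q \<subset> P \<Longrightarrow> Q \<noteq> {} \<Longrightarrow> scd (merge_step Q) card (card Q + 1) (carrier (NC Q))"
  shows "scd (merge_step P) card (card P + 1) (loose P p q)"
  using outermost_point.finite[OF assms(1)] assms
proof (induction P rule: finite_psubset_induct)
  case (psubset P)
  then interpret outermost_point X Y P p q by simp
  let ?R = "{z \<in> P. X z = 0 \<and> 0 < Y z}"
  show ?case
  proof (cases "?R = {}")
    case True
    \<comment> \<open>With no point on the other open half-axis, the block of \<open>p\<close> can
      have no second member, so nothing is loose.\<close>
    have False if \<pi>: "\<pi> \<in> loose P p q" for \<pi>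
    proof -
      have part: "partition_on P \<pi>" and "{p} \<notin> \<pi>"
        using \<pi> by (auto simp: loose_def carrier_NC)
      obtain D where D: "D \<in> \<pi>" "p \<in> D"
        using partition_on_ex_block[OF part p(1)] by blast
      have "D \<noteq> {p}"
        using D(1) \<open>{p} \<notin> \<pi>\<close> by blast
      then obtain s where s: "s \<in> D" "s \<noteq> p"
        using D(2) by blast
      then show False
        using loose_block[OF \<pi> D s] True partition_on_block_subset[OF part D(1)] by blast
    qed
    then have "loose P p q = {}" by blast
    then show ?thesis by (simp add: scd.empty)
  next
    case False
    then obtain r where r_max': "r \<in> ?R" "\<forall>z\<in>?R. Y z \<le> Y r"
      using ex_max_on[of ?R Y] finite by auto
    then have r: "r \<in> P" "X r = 0" "0 < Y r"
      by auto
    have r_max: "Y z \<le> Y r" if "z \<in> P" "X z = 0" for z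
      using r_max' that by (cases "0 < Y z") auto
    have pr: "p \<noteq> r" and qpr: "q \<in> P - {p, r}"
      using pos r q by auto
    have un: "{p, r} \<union> (P - {p, r}) = P"
      using p r by auto
    have card_P: "card P = card (P - {p, r}) + 2"
      using card_Un_disjoint[of "{p, r}" "P - {p, r}"] un pr finite by simp
    let ?S = "{\<pi> \<in> loose P p q. {p, r} \<notin> \<pi>}"
    \<comment> \<open>\<open>q\<close> survives the removal of \<open>p\<close> and
      \<open>r\<close>, so the hypothesis on nonempty smaller sets applies. The new total is
      \<open>card P + 1\<close> because two points were removed.\<close>
    have "scd (merge_step ({p, r} \<union> (P - {p, r}))) card (card (P - {p, r}) + 1 + 2)
      (insert {p, r} ` carrier (NC (P - {p, r})))"
      by (rule scd_insert_block) (use psubset.prems(2)[of "P - {p, r}"] finite p qpr in auto)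
    moreover have "{\<pi> \<in> loose P p q. {p, r} \<in> \<pi>} = insert {p, r} ` carrier (NC (P - {p, r}))"
      by (rule loose_outermost_pair[OF r]) (rule r_max)
    ultimately have pair: "scd (merge_step P) card (card P + 1) {\<pi> \<in> loose P p q. {p, r} \<in> \<pi>}"
      unfolding un card_P by simp
    have rest: "scd (merge_step P) card (card P + 1) ?S"
    proof (cases "{z \<in> P - {r}. X z = 0} = {}")
      case True
      \<comment> \<open>Only \<open>r\<close> can join \<open>p\<close>, so the block of
        \<open>p\<close> would be the excluded \<open>{p, r}\<close>.\<close>
      have False if "\<pi> \<in> ?S" for \<pi>
      proof -
        have \<pi>: "\<pi> \<in> loose P p q" "{p, r} \<notin> \<pi>" and part: "partition_on P \<pi>" and "{p} \<notin> \<pi>"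
          using that by (auto simp: loose_def carrier_NC)
        obtain D where D: "D \<in> \<pi>" "p \<in> D"
          using partition_on_ex_block[OF part p(1)] by blast
        have "s = r" if "s \<in> D" "s \<noteq> p" for s
          using loose_block(1)[OF \<pi>(1) D that] True partition_on_block_subset[OF part D(1)] that
          by blast
        then have "D = {p} \<or> D = {p, r}"
          using D(2) by blast
        then show False
          using D(1) \<pi>(2) \<open>{p} \<notin> \<pi>\<close> by metis
      qed
      then have "?S = {}" by blast
      then show ?thesis by (metis scd.empty)
    next
      case False
      \<comment> \<open>Unlike \<open>r\<close>, the neighbour \<open>r'\<close> may be the
        origin.\<close>
      then obtain r' where "r' \<in> {z \<in> P - {r}. X z = 0}" "\<forall>z\<in>{z \<in> P - {r}. X z = 0}. Y z \<le> Y r'"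
        using ex_max_on[of "{z \<in> P - {r}. X z = 0}" Y] finite by auto
      then have r': "r' \<in> P" "r' \<noteq> r" "X r' = 0"
        and r'_max: "\<And>z. z \<in> P \<Longrightarrow> z \<noteq> r \<Longrightarrow> X z = 0 \<Longrightarrow> Y z \<le> Y r'"
        by auto
      have "Y r' < Y r"
        using r_max[OF r'(1,3)] eqI[of r' r] r(2) r'(2,3) by force
      then have dec: "?S = insert {r} ` loose (P - {r}) p q \<union> attach r r' ` loose (P - {r}) p q"
        by (rule loose_attach_decomposition[OF r(1,2) r'(1,3)]) (rule r'_max)
      have "outermost_point X Y (P - {r}) p q"
        by unfold_locales (use finite axes p q pr qpr max in auto)
      then have "scd (merge_step (P - {r})) card (card (P - {r}) + 1) (loose (P - {r}) p q)"
        using psubset.prems(2) r(1) by (intro psubset.IH) auto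
      then have "scd (merge_step (insert r (P - {r}))) card (Suc (card (P - {r}) + 1))
        (insert {r} ` loose (P - {r}) p q \<union> attach r r' ` loose (P - {r}) p q)"
        by (rule scd_attach) (use finite r' in \<open>auto simp: loose_def\<close>)
      moreover have ins: "insert r (P - {r}) = P" and card: "card P = Suc (card (P - {r}))"
        using r(1) finite card_Suc_Diff1[of P r] by auto
      ultimately show ?thesis
        unfolding dec ins card by (simp only: add_Suc)
    qed
    have "scd (merge_step P) card (card P + 1) ({\<pi> \<in> loose P p q. {p, r} \<in> \<pi>} \<union> ?S)"
      by (rule scd_Un[OF pair rest]) auto
    moreover have "{\<pi> \<in> loose P p q. {p, r} \<in> \<pi>} \<union> ?S = loose P p q"
      by auto
    ultimately show ?thesis by simp
  qed
qed

text \<open>Two points on one closed half-axis ensure that its outermost point \<open>p\<close> has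
  a neighbour \<open>q\<close> there.\<close>

lemma scd_NC_two_on_axis:
  assumes P: "finite P" "P \<subseteq> axes"
    and ab: "a \<in> P" "b \<in> P" "a \<noteq> b" "Y a = 0" "Y b = 0"
    and IH: "\<And>Q. Q \<subset> P \<Longrightarrow> Q \<noteq> {} \<Longrightarrow> scd (merge_step Q) card (card Q + 1) (carrier (NC Q))"
  shows "scd (merge_step P) card (card P + 1) (carrier (NC P))"
proof -
  let ?A = "{z \<in> P. Y z = 0}"
  have "finite ?A" "?A \<noteq> {}"
    using P ab by auto
  then obtain p where p: "p \<in> ?A" "\<forall>z\<in>?A. X z \<le> X p"
    using ex_max_on[of ?A X] by auto
  have "finite (?A - {p})" "?A - {p} \<noteq> {}"
    using P ab by auto
  then obtain q where q: "q \<in> ?A - {p}" "\<forall>z\<in>?A - {p}. X z \<le> X q"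
    using ex_max_on[of "?A - {p}" X] by metis
  have "X q < X p"
    using p q eqI[of q p] by force
  then interpret outermost_point X Y P p q
    by unfold_locales (use P p q in auto)
  have "attachable p q (P - {p})"
    by (rule attachable_outermost) (use finite axes p q max \<open>X q < X p\<close> in auto)
  moreover have "insert p (P - {p}) = P"
    using p by auto
  moreover have "scd (merge_step (P - {p})) card (card (P - {p}) + 1) (carrier (NC (P - {p})))"
    using p q by (intro IH) auto
  moreover have "scd (merge_step P) card (card P + 1) (loose P p q)"
    by (rule scd_loose[OF outermost_point_axioms IH])
  ultimately show ?thesis
    using scd_NC_insert[of p q "P - {p}"] finite by simp
qed

end

section \<open>Base cases and the final induction\<close>

lemma scd_NC_singleton: "scd (merge_step {p}) card (card {p} + 1) (carrier (NC {p}))"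
proof -
  have "\<pi> = {{p}}" if \<pi>: "partition_on {p} \<pi>" for \<pi>
  proof -
    have "B = {p}" if "B \<in> \<pi>" for B
      using partition_on_block_subset[OF \<pi> that] partition_onD3[OF \<pi>] that
      by (auto simp: subset_singleton_iff)
    moreover have "\<exists>B\<in>\<pi>. p \<in> B"
      using partition_on_ex_block[OF \<pi>] by blast
    ultimately show ?thesis by blast
  qed
  then have "carrier (NC {p}) = {{{p}}}"
    by (auto simp: carrier_NC noncrossing_def partition_on_space)
  then show ?thesis
    by (simp add: scd_singleton)
qed

text \<open>Covers one point on each axis, where \<open>p\<close> has no neighbour on its own axis.
  With only two points, \<open>q\<close> can take that role and no partition is loose.\<close>

lemma scd_NC_pair:
  assumes "p \<noteq> q"
  shows "scd (merge_step {p, q}) card (card {p, q} + 1) (carrier (NC {p, q}))"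
proof -
  have att: "attachable p q {q}"
    unfolding attachable_def
  proof (intro conjI allI impI)
    fix B C
    assume "B \<subseteq> {q}" "C \<subseteq> {q}" "q \<in> B" "disjnt (convex hull B) (convex hull C)"
    then have "C = {}"
      by (auto simp: subset_singleton_iff disjnt_iff)
    then show "disjnt (convex hull insert p B) (convex hull C)"
      by simp
  qed (use assms in auto)
  have "loose {p, q} p q = {}"
  proof -
    have False if \<pi>: "partition_on {p, q} \<pi>" "{p} \<notin> \<pi>" "\<forall>B\<in>\<pi>. p \<in> B \<longrightarrow> q \<notin> B" for \<pi>
    proof -
      obtain B where B: "B \<in> \<pi>" "p \<in> B"
        using partition_on_ex_block[OF \<pi>(1)] by blast
      then have "B = {p}"
        using partition_on_block_subset[OF \<pi>(1) B(1)] \<pi>(3) by blast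
      then show False
        using B \<pi>(2) by simp
    qed
    then show ?thesis
      by (auto simp: loose_def carrier_NC)
  qed
  then show ?thesis
    using scd_NC_insert[OF att _ scd_NC_singleton] by (simp add: scd.empty)
qed

lemma scd_NC_axes:
  assumes "finite P" "P \<subseteq> axes" "P \<noteq> {}"
  shows "scd (merge_step P) card (card P + 1) (carrier (NC P))"
  using assms
proof (induction P rule: finite_psubset_induct)
  case (psubset P)
  have IH: "scd (merge_step Q) card (card Q + 1) (carrier (NC Q))" if "Q \<subset> P" "Q \<noteq> {}" for Q
    using psubset.IH[OF that(1)] psubset.prems that by blast
  have re_im: "coordinate_pair Re Im" "coordinate_pair Im Re"
    by unfold_locales auto
  note two = re_im[THEN coordinate_pair.scd_NC_two_on_axis, OF psubset.hyps psubset.prems(1)]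
  show ?case
  proof (cases "\<exists>a\<in>P. \<exists>b\<in>P. a \<noteq> b \<and> (Im a = 0 \<and> Im b = 0 \<or> Re a = 0 \<and> Re b = 0)")
    case True
    then show ?thesis
      using two IH by blast
  next
    case False
    obtain p where p: "p \<in> P"
      using psubset.prems by blast
    show ?thesis
    proof (cases "P = {p}")
      case True
      then show ?thesis by (simp only: scd_NC_singleton)
    next
      case False
      then obtain q where q: "q \<in> P" "q \<noteq> p"
        using p by blast
      \<comment> \<open>Each closed half-axis now holds at most one point, so \<open>P\<close> has
        no point besides \<open>p\<close> and \<open>q\<close>.\<close>
      have "Re z = 0 \<or> Im z = 0" if "z \<in> P" for z
        using that psubset.prems by (auto simp: axes_def)
      then have "z = p \<or> z = q" if "z \<in> P" for z
        using p q that \<open>\<not> (\<exists>a\<in>P. _ a)\<close> by metis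
      then have "P = {p, q}"
        using p q by blast
      then show ?thesis
        using scd_NC_pair q(2) by metis
    qed
  qed
qed

lemma axes_symmetric_chain_decomposition:
  assumes "finite P" "P \<subseteq> axes"
  shows "\<exists>D. symmetric_chain_decomposition (NC P) (nc_rank P) D"
proof (cases "P = {}")
  case True
  then show ?thesis
    using symmetric_chain_decomposition_NC_empty by simp
next
  case False
  then show ?thesis
    using symmetric_chain_decomposition_NC assms scd_NC_axes by blast
qed

theorem theorem3p2:
  fixes m n :: nat and x y :: "nat \<Rightarrow> complex" and U V :: "complex set"
  assumes "inj_on x {1..m}" and "\<And>i. i \<in> {1..m} \<Longrightarrow> Re (x i) > 0 \<and> Im (x i) = 0"
    and "inj_on y {1..n}" and "\<And>j. j \<in> {1..n} \<Longrightarrow> Re (y j) = 0 \<and> Im (y j) > 0"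
    and "U = x ` {1..m} \<union> y ` {1..n}" and "V = U \<union> {0}"
  shows "(\<exists>D. symmetric_chain_decomposition (NC U) (nc_rank U) D) \<and>
         (\<exists>D. symmetric_chain_decomposition (NC V) (nc_rank V) D)"
proof -
  \<comment> \<open>The origin lies on both closed half-axes, so one result covers \<open>U\<close>
    and \<open>V\<close>.\<close>
  have "finite V" "V \<subseteq> axes"
    using assms(2,4) by (auto simp: assms(5,6) axes_def less_imp_le)
  moreover have "U \<subseteq> V"
    using assms(6) by blast
  ultimately show ?thesis
    using axes_symmetric_chain_decomposition finite_subset by (metis order_trans)
qed

end
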